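(* There is an absolute constant $C>0$ such that the following holds. Let $p \in (0,\tfrac12]$, $K\ge 1$, and let $f:\{0,1\}^n\to\{0,1\}$ be a Boolean function with $p\,\mathrm{I}[f] < K\mu_p(f)$. Then there is a set $J\subseteq[n]$ with $|J|\le CK$ such that $\mu_p(f_{J\to1}) \ge e^{-CK}$.
   Context: $\mu_p$ is the $p$-biased product measure on $\{0,1\}^n$, $\mu_p(f)=\mathbb{E}_{\mu_p}[f]$. The $i$-th influence is $\mathrm{I}_i[f] = \Pr_{\mathbf{x}\sim\mu_p}[f(\mathbf{x}\oplus e_i)\neq f(\mathbf{x})]$ and $\mathrm{I}[f]=\sum_i \mathrm{I}_i[f]$. $f_{J\to1}$ is the function on $\{0,1\}^{[n]\setminus J}$ obtained by setting all coordinates in $J$ to $1$, with measure $\mu_p$ on the remaining coordinates. *)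

theory Defs
  imports "HOL-Probability.Probability"
begin

text \<open>
  A point of the cube \<open>{0,1}\<^sup>S\<close>, for a finite set \<open>S\<close> of coordinates, is a function
  \<open>x :: nat \<Rightarrow> bool\<close> that is \<open>False\<close> outside \<open>S\<close>. A Boolean function on the cube is any
  \<open>f :: (nat \<Rightarrow> bool) \<Rightarrow> bool\<close>; as \<open>biased_cube S p\<close> is supported on such points, its values
  elsewhere play no role.
\<close>

definition biased_cube :: "nat set \<Rightarrow> real \<Rightarrow> (nat \<Rightarrow> bool) pmf" where
  "biased_cube S p = Pi_pmf S False (\<lambda>_. bernoulli_pmf p)"

definition mu :: "nat set \<Rightarrow> real \<Rightarrow> ((nat \<Rightarrow> bool) \<Rightarrow> bool) \<Rightarrow> real" where
  "mu S p f = measure_pmf.expectation (biased_cube S p) (\<lambda>x. of_bool (f x))"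

definition flip :: "nat \<Rightarrow> (nat \<Rightarrow> bool) \<Rightarrow> (nat \<Rightarrow> bool)" where
  "flip i x = x(i := \<not> x i)"

definition influence :: "nat set \<Rightarrow> real \<Rightarrow> ((nat \<Rightarrow> bool) \<Rightarrow> bool) \<Rightarrow> nat \<Rightarrow> real" where
  "influence S p f i = measure_pmf.prob (biased_cube S p) {x. f (flip i x) \<noteq> f x}"

definition total_influence :: "nat set \<Rightarrow> real \<Rightarrow> ((nat \<Rightarrow> bool) \<Rightarrow> bool) \<Rightarrow> real" where
  "total_influence S p f = (\<Sum>i\<in>S. influence S p f i)"

text \<open>For \<open>f\<close> on \<open>{0,1}\<^sup>S\<close>, the restriction below is to be read as a function on
  \<open>{0,1}\<close> to the power \<open>S - J\<close>, so its measure is \<open>mu (S - J) p (restrict_one J f)\<close>.\<close>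

definition restrict_one :: "nat set \<Rightarrow> ((nat \<Rightarrow> bool) \<Rightarrow> bool) \<Rightarrow> ((nat \<Rightarrow> bool) \<Rightarrow> bool)" where
  "restrict_one J f = (\<lambda>y. f (\<lambda>i. if i \<in> J then True else y i))"

end

theory Submission
  imports Defs
begin

text \<open>
  Expand \<open>f\<close> in the \<open>p\<close>-biased characters, with coefficients \<open>c T\<close>. Since
  \<open>p (1 - p) I[f] = (\<Sum>T. |T| (c T)\<^sup>2)\<close>, at least half of the mass \<open>\<mu>(f) = (\<Sum>T. (c T)\<^sup>2)\<close> lies in
  degrees at most \<open>d = 2 K\<close>. Let \<open>g\<close> be the part of degree at most \<open>d\<close> and \<open>M = E[f g]\<close> its mass, so
  that \<open>M ^ 4 \<le> \<mu>(f) ^ 3 E[g ^ 4]\<close> by applying Cauchy-Schwarz twice. A hypercontractive inequality valid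
  for every bias bounds \<open>E[g ^ 4]\<close> by a sum over \<open>S\<close> of \<open>(p (1 - p)) ^ - |S|\<close> times the square of
  the mass of the coefficients above \<open>S\<close>. For a Boolean \<open>f\<close> that mass is \<open>(p (1 - p)) ^ |S|\<close> times the
  squared norm of the discrete derivative of \<open>f\<close> along \<open>S\<close>, which is small
  if \<open>\<mu>(f\<^bsub>J \<rightarrow> 1\<^esub>) \<le> \<beta>\<close> for all \<open>J \<subseteq> S\<close>: a coordinate set to \<open>0\<close> costs only a factor \<open>1 / (1 - p) \<le> 2\<close>.
  If this bound holds for all \<open>J\<close> of size at most \<open>d\<close>, then \<open>E[g ^ 4] \<le> 192 ^ d \<beta> M\<close>, and
  hence \<open>\<beta> \<ge> 192 ^ - d / 8\<close>.
\<close>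

section \<open>Sums over intervals in the subset order\<close>

lemma finite_set_Icc: "finite N \<Longrightarrow> finite {S..N :: 'a set}"
  by (rule finite_subset[of _ "Pow N"]) auto

lemma insert_image_Icc:
  assumes "i \<notin> N" "i \<notin> S"
  shows "insert i ` {S..N} = {insert i S..insert i N}"
proof (intro equalityI subsetI)
  fix T assume "T \<in> {insert i S..insert i N}"
  then have "T = insert i (T - {i})" "T - {i} \<in> {S..N}"
    using assms by auto
  then show "T \<in> insert i ` {S..N}" by blast
qed (use assms in auto)

lemma sum_Icc_insert_both:
  fixes h :: "'a set \<Rightarrow> real"
  assumes "i \<notin> N" "i \<notin> S"
  shows "sum h {insert i S..insert i N} = (\<Sum>T\<in>{S..N}. h (insert i T))"
proof -
  have "inj_on (insert i) {S..N}"
  proof (rule inj_onI)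
    fix T U assume "T \<in> {S..N}" "U \<in> {S..N}" "insert i T = insert i U"
    moreover from this have "i \<notin> T" "i \<notin> U" using assms by auto
    ultimately show "T = U" by (simp add: insert_ident)
  qed
  then show ?thesis
    unfolding insert_image_Icc[OF assms, symmetric] by (simp add: sum.reindex)
qed

text \<open>Sets without \<open>i\<close> pair with sets containing \<open>i\<close>. This makes
  Fourier sums recursive in the coordinates, matching the recursion \<open>expect_insert\<close> for
  expectations.\<close>

lemma sum_Icc_insert:
  fixes h :: "'a set \<Rightarrow> real"
  assumes "finite N" "i \<notin> N" "i \<notin> S"
  shows "sum h {S..insert i N} = (\<Sum>T\<in>{S..N}. h T + h (insert i T))"
proof -
  have eq: "{S..insert i N} = {S..N} \<union> {insert i S..insert i N}"
    using assms by auto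
  have "sum h {S..insert i N} = sum h {S..N} + sum h {insert i S..insert i N}"
    unfolding eq using assms by (intro sum.union_disjoint finite_set_Icc) auto
  then show ?thesis
    using sum_Icc_insert_both[OF assms(2,3)] by (simp add: sum.distrib)
qed

section \<open>Expectation on the biased cube\<close>

locale bias =
  fixes p :: real
  assumes p_pos: "0 < p" and p_le: "p \<le> 1 / 2"
begin

abbreviation q :: real where "q \<equiv> 1 - p"

lemma q_pos: "0 < q"
  using p_le by simp

definition expect :: "nat set \<Rightarrow> ((nat \<Rightarrow> bool) \<Rightarrow> real) \<Rightarrow> real" where
  "expect N f = measure_pmf.expectation (biased_cube N p) f"

lemma finite_biased_cube: "finite N \<Longrightarrow> finite (set_pmf (biased_cube N p))"
  unfolding biased_cube_def set_Pi_pmf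
  by (intro finite_PiE_dflt) (auto intro: finite_subset[of _ UNIV])

lemma expect_integrable: "finite N \<Longrightarrow> integrable (biased_cube N p) (f :: _ \<Rightarrow> real)"
  by (intro integrable_measure_pmf_finite finite_biased_cube)

lemma expect_add: "finite N \<Longrightarrow> expect N (\<lambda>x. f x + g x) = expect N f + expect N g"
  unfolding expect_def by (simp add: expect_integrable)

lemma expect_sum: "finite N \<Longrightarrow> expect N (\<lambda>x. \<Sum>a\<in>A. f a x) = (\<Sum>a\<in>A. expect N (f a))"
  unfolding expect_def by (simp add: expect_integrable)

lemma expect_cmult: "expect N (\<lambda>x. c * f x) = c * expect N f"
  unfolding expect_def by simp

lemma expect_mono: "finite N \<Longrightarrow> (\<And>x. f x \<le> g x) \<Longrightarrow> expect N f \<le> expect N g"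
  unfolding expect_def by (intro integral_mono) (auto simp: expect_integrable)

lemma expect_nonneg: "(\<And>x. 0 \<le> f x) \<Longrightarrow> 0 \<le> expect N f"
  unfolding expect_def by (intro Bochner_Integration.integral_nonneg)

lemma expect_empty: "expect {} f = f (\<lambda>_. False)"
  by (simp add: expect_def biased_cube_def)

lemma expect_insert:
  assumes "finite N" "i \<notin> N"
  shows "expect (insert i N) f = p * expect N (\<lambda>x. f (x(i := True))) + q * expect N (\<lambda>x. f (x(i := False)))"
proof -
  have "biased_cube (insert i N) p =
      bernoulli_pmf p \<bind> (\<lambda>y. map_pmf (\<lambda>x. x(i := y)) (biased_cube N p))"
    unfolding biased_cube_def Pi_pmf_insert'[OF assms] map_pmf_def by simp
  then have "expect (insert i N) f = (\<Sum>y\<in>UNIV. pmf (bernoulli_pmf p) y *\<^sub>R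
      measure_pmf.expectation (map_pmf (\<lambda>x. x(i := y)) (biased_cube N p)) f)"
    unfolding expect_def using finite_biased_cube[OF assms(1)]
    by (simp only:) (rule pmf_expectation_bind, auto)
  then show ?thesis
    using p_pos p_le by (simp add: UNIV_bool expect_def)
qed

lemma cauchy_schwarz_expect:
  assumes "finite N"
  shows "(expect N (\<lambda>x. f x * g x))\<^sup>2 \<le> expect N (\<lambda>x. (f x)\<^sup>2) * expect N (\<lambda>x. (g x)\<^sup>2)"
proof -
  define A B D where "A = expect N (\<lambda>x. (f x)\<^sup>2)"
    and "B = expect N (\<lambda>x. f x * g x)"
    and "D = expect N (\<lambda>x. (g x)\<^sup>2)"
  have quad: "0 \<le> s\<^sup>2 * A + 2 * s * t * B + t\<^sup>2 * D" for s t
  proof -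
    have "0 \<le> expect N (\<lambda>x. (s * f x + t * g x)\<^sup>2)"
      by (intro expect_nonneg) simp
    also have "(\<lambda>x. (s * f x + t * g x)\<^sup>2) =
        (\<lambda>x. (s\<^sup>2 * (f x)\<^sup>2 + (2 * s * t) * (f x * g x)) + t\<^sup>2 * (g x)\<^sup>2)"
      by (auto simp: power2_eq_square algebra_simps)
    also have "expect N \<dots> = s\<^sup>2 * A + 2 * s * t * B + t\<^sup>2 * D"
      using assms by (simp only: expect_add expect_cmult A_def B_def D_def)
    finally show ?thesis .
  qed
  have "0 \<le> D" unfolding D_def by (intro expect_nonneg) simp
  show ?thesis
  proof (cases "D = 0")
    case True
    have "B = 0"
    proof (rule ccontr)
      assume "B \<noteq> 0"
      then show False
        \<comment> \<open>With \<open>D = 0\<close> the form is \<open>A + 2 * t * B\<close> at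
          \<open>s = 1\<close>; this choice of \<open>t\<close> makes it -1.\<close>
        using quad[of 1 "- (A + 1) / (2 * B)"] True
        by (simp add: field_simps)
    qed
    then show ?thesis using True by (simp add: B_def D_def)
  next
    case False
    have "0 \<le> D * (A * D - B\<^sup>2)"
      \<comment> \<open>At \<open>s = D\<close>, \<open>t = - B\<close> the form collapses to
        \<open>D * (A * D - B\<^sup>2)\<close>.\<close>
      using quad[of D "- B"] by (simp add: power2_eq_square algebra_simps)
    then have "B\<^sup>2 \<le> A * D"
      using False \<open>0 \<le> D\<close> by (simp add: zero_le_mult_iff)
    then show ?thesis by (simp add: A_def B_def D_def)
  qed
qed

section \<open>Biased characters and Fourier coefficients\<close>

text \<open>This is \<open>(b - p) / sqrt (p * q)\<close>, the coordinate normalised to mean 0 and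
  variance 1.\<close>

definition chi :: "bool \<Rightarrow> real" where
  "chi b = (if b then sqrt (q / p) else - sqrt (p / q))"

lemma chi_mean: "p * chi True + q * chi False = 0"
  and chi_diff: "p * chi True = sqrt (p * q)" "q * chi False = - sqrt (p * q)"
proof -
  have "p * q = p\<^sup>2 * (q / p)" "p * q = q\<^sup>2 * (p / q)"
    using p_pos q_pos by (simp_all add: power2_eq_square)
  then have "sqrt (p * q) = p * sqrt (q / p)" "sqrt (p * q) = q * sqrt (p / q)"
    using p_pos q_pos by (metis real_sqrt_mult real_sqrt_abs abs_of_pos)+
  then show 1: "p * chi True = sqrt (p * q)" and 2: "q * chi False = - sqrt (p * q)"
    by (simp_all add: chi_def)
  show "p * chi True + q * chi False = 0" using 1 2 by simp
qed

lemma chi_sq: "(chi True)\<^sup>2 = q / p" "(chi False)\<^sup>2 = p / q"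
  unfolding chi_def using p_pos q_pos by auto

lemma chi_var: "p * (chi True)\<^sup>2 + q * (chi False)\<^sup>2 = 1"
  unfolding chi_sq using p_pos q_pos by simp

text \<open>The fourth moment equals \<open>(p^3 + q^3) / (p * q)\<close>, and
  \<open>p^3 + q^3 = 1 - 3 * (p * q)\<close>. It grows like \<open>1 / p\<close> for small
  \<open>p\<close>; this loss reappears as a factor \<open>1 / (p * q)\<close> per coordinate in the
  hypercontractive inequality.\<close>

lemma chi_fourth: "p * (chi True)^4 + q * (chi False)^4 \<le> 1 / (p * q)"
proof -
  have "(chi b)^4 = ((chi b)\<^sup>2)\<^sup>2" for b by simp
  then have "p * (chi True)^4 + q * (chi False)^4 = p * (q / p)\<^sup>2 + q * (p / q)\<^sup>2"
    by (simp only: chi_sq)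
  also have "\<dots> = (q^3 + p^3) / (p * q)"
    using p_pos q_pos by (simp add: power2_eq_square power3_eq_cube divide_simps)
  also have "\<dots> \<le> 1 / (p * q)"
  proof (intro divide_right_mono)
    have "q^3 + p^3 = 1 - 3 * (p * q)" by (simp add: power3_eq_cube algebra_simps)
    also have "\<dots> \<le> 1" using p_pos q_pos by simp
    finally show "q^3 + p^3 \<le> 1" .
  qed (use p_pos q_pos in simp)
  finally show ?thesis .
qed

definition character :: "nat set \<Rightarrow> (nat \<Rightarrow> bool) \<Rightarrow> real" where
  "character S x = (\<Prod>i\<in>S. chi (x i))"

lemma character_upd: "i \<notin> S \<Longrightarrow> character S (x(i := b)) = character S x"
  unfolding character_def by (intro prod.cong) auto

lemma character_insert_upd:
  "finite S \<Longrightarrow> i \<notin> S \<Longrightarrow> character (insert i S) (x(i := b)) = chi b * character S x"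
  using character_upd[of i S x b] by (simp add: character_def)

definition coef :: "nat set \<Rightarrow> ((nat \<Rightarrow> bool) \<Rightarrow> real) \<Rightarrow> nat set \<Rightarrow> real" where
  "coef N f S = expect N (\<lambda>x. f x * character S x)"

lemma coef_add: "finite N \<Longrightarrow> coef N (\<lambda>x. f x + g x) S = coef N f S + coef N g S"
  by (simp add: coef_def expect_add algebra_simps)

lemma coef_cmult: "coef N (\<lambda>x. c * f x) S = c * coef N f S"
  using expect_cmult[of N c "\<lambda>x. f x * character S x"] by (simp add: coef_def mult.assoc)

lemma coef_diff: "finite N \<Longrightarrow> coef N (\<lambda>x. f x - g x) S = coef N f S - coef N g S"
  using coef_add[of N f "\<lambda>x. (-1) * g x" S] by (simp only: coef_cmult) simp

lemma coef_insert_notin: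
  assumes "finite N" "i \<notin> N" "i \<notin> S"
  shows "coef (insert i N) f S =
    p * coef N (\<lambda>x. f (x(i := True))) S + q * coef N (\<lambda>x. f (x(i := False))) S"
  unfolding coef_def expect_insert[OF assms(1,2)] character_upd[OF assms(3)] ..

text \<open>Since \<open>p * chi True\<close> and \<open>q * chi False\<close> are opposite, a
  character containing \<open>i\<close> sees only the discrete derivative along \<open>i\<close>.
  The factor \<open>sqrt (p * q)\<close>, once squared, is what later cancels the fourth-moment
  loss.\<close>

lemma coef_insert_in:
  assumes "finite N" "i \<notin> N" "finite S" "i \<notin> S"
  shows "coef (insert i N) f (insert i S) =
    sqrt (p * q) * coef N (\<lambda>x. f (x(i := True)) - f (x(i := False))) S"
proof -
  have "coef (insert i N) f (insert i S) =
      p * (chi True * coef N (\<lambda>x. f (x(i := True))) S) +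
      q * (chi False * coef N (\<lambda>x. f (x(i := False))) S)"
    unfolding coef_def expect_insert[OF assms(1,2)] character_insert_upd[OF assms(3,4)]
    by (simp only: mult.left_commute expect_cmult)
  also have "\<dots> = (p * chi True) * coef N (\<lambda>x. f (x(i := True))) S +
      (q * chi False) * coef N (\<lambda>x. f (x(i := False))) S"
    by (simp only: mult.assoc)
  finally show ?thesis
    unfolding chi_diff coef_diff[OF assms(1)] by (simp add: algebra_simps)
qed

section \<open>Mass above a set, Parseval and influences\<close>

definition weight :: "nat set \<Rightarrow> nat set \<Rightarrow> ((nat \<Rightarrow> bool) \<Rightarrow> real) \<Rightarrow> real" where
  "weight N S f = (\<Sum>T\<in>{S..N}. (coef N f T)\<^sup>2)"

lemma weight_insert:
  assumes "finite N" "i \<notin> N" "i \<notin> S"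
  shows "weight (insert i N) (insert i S) f =
    p * q * weight N S (\<lambda>x. f (x(i := True)) - f (x(i := False)))"
proof -
  have "weight (insert i N) (insert i S) f =
      (\<Sum>T\<in>{S..N}. (coef (insert i N) f (insert i T))\<^sup>2)"
    unfolding weight_def using assms(2,3) by (rule sum_Icc_insert_both)
  also have "\<dots> = (\<Sum>T\<in>{S..N}. p * q *
      (coef N (\<lambda>x. f (x(i := True)) - f (x(i := False))) T)\<^sup>2)"
  proof (intro sum.cong refl)
    fix T assume "T \<in> {S..N}"
    then have "finite T" "i \<notin> T" using assms finite_subset by auto
    then show "(coef (insert i N) f (insert i T))\<^sup>2 =
        p * q * (coef N (\<lambda>x. f (x(i := True)) - f (x(i := False))) T)\<^sup>2"
      using assms p_pos q_pos by (simp add: coef_insert_in power_mult_distrib)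
  qed
  finally show ?thesis by (simp add: weight_def sum_distrib_left)
qed

text \<open>Splits a derivative into its two Boolean restrictions, so that the induction in
  \<open>weight_le_of_restrict\<close> never leaves Boolean functions.\<close>

lemma weight_diff_le:
  assumes "finite N"
  shows "weight N S (\<lambda>x. f x - g x) \<le> 2 * weight N S f + 2 * weight N S g"
proof -
  have "(a - b)\<^sup>2 \<le> 2 * a\<^sup>2 + 2 * b\<^sup>2" for a b :: real
    using zero_le_power2[of "a + b"] by (simp add: power2_eq_square algebra_simps)
  then show ?thesis
    unfolding weight_def coef_diff[OF assms]
    by (simp add: sum_distrib_left flip: sum.distrib) (intro sum_mono, simp)
qed

lemma parseval:
  assumes "finite N"
  shows "weight N {} f = expect N (\<lambda>x. (f x)\<^sup>2)"
  using assms
proof (induction N arbitrary: f)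
  case empty
  have "{{}..{}} = {{} :: nat set}" by auto
  then show ?case by (simp add: weight_def coef_def expect_empty character_def)
next
  case (insert i N)
  define f1 f0 where "f1 = (\<lambda>x. f (x(i := True)))" and "f0 = (\<lambda>x. f (x(i := False)))"
  have "weight (insert i N) {} f =
      (\<Sum>T\<in>{{}..N}. (coef (insert i N) f T)\<^sup>2) + weight (insert i N) {i} f"
    unfolding weight_def using insert.hyps
    by (simp add: sum_Icc_insert sum_Icc_insert_both sum.distrib)
  also have "(\<Sum>T\<in>{{}..N}. (coef (insert i N) f T)\<^sup>2) = weight N {} (\<lambda>x. p * f1 x + q * f0 x)"
    unfolding weight_def using insert.hyps
  proof (intro sum.cong refl)
    fix T assume "T \<in> {{}..N}"
    then have "i \<notin> T" using insert.hyps by auto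
    then show "(coef (insert i N) f T)\<^sup>2 = (coef N (\<lambda>x. p * f1 x + q * f0 x) T)\<^sup>2"
      unfolding f1_def f0_def using insert.hyps by (simp add: coef_insert_notin coef_add coef_cmult)
  qed
  also have "weight (insert i N) {i} f = p * q * weight N {} (\<lambda>x. f1 x - f0 x)"
    using weight_insert[of N i "{}" f] insert.hyps by (simp add: f1_def f0_def)
  also have "weight N {} (\<lambda>x. p * f1 x + q * f0 x) + p * q * weight N {} (\<lambda>x. f1 x - f0 x) =
      expect N (\<lambda>x. (p * f1 x + q * f0 x)\<^sup>2 + p * q * (f1 x - f0 x)\<^sup>2)"
    using insert.hyps by (simp only: insert.IH expect_add expect_cmult)
  \<comment> \<open>Mean squared plus variance of a two-valued variable is its second moment; this
    uses \<open>p + q = 1\<close>.\<close>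
  also have "(\<lambda>x. (p * f1 x + q * f0 x)\<^sup>2 + p * q * (f1 x - f0 x)\<^sup>2) =
      (\<lambda>x. p * (f1 x)\<^sup>2 + q * (f0 x)\<^sup>2)"
    by (auto simp: power2_eq_square algebra_simps)
  also have "expect N \<dots> = expect (insert i N) (\<lambda>x. (f x)\<^sup>2)"
    unfolding f1_def f0_def expect_insert[OF insert.hyps] expect_add[OF insert.hyps(1)] expect_cmult ..
  finally show ?case .
qed

lemma mu_eq_expect: "mu N p f = expect N (\<lambda>x. of_bool (f x))"
  by (simp add: mu_def expect_def)

text \<open>The derivative of a Boolean function takes values in {-1, 0, 1}, so its square indicates
  that flipping \<open>i\<close> changes the value; Parseval turns its expectation into
  mass.\<close>

lemma weight_singleton_influence:
  assumes "finite N" "i \<in> N"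
  shows "weight N {i} (\<lambda>x. of_bool (f x)) = p * q * influence N p f i"
proof -
  define N' where "N' = N - {i}"
  have N: "N = insert i N'" "finite N'" "i \<notin> N'" using assms by (auto simp: N'_def)
  define h where "h x = (of_bool (f (x(i := True))) - of_bool (f (x(i := False))) :: real)\<^sup>2" for x
  have "influence N p f i = expect N (\<lambda>x. of_bool (f (flip i x) \<noteq> f x))"
  proof -
    have "(\<lambda>x. of_bool (f (flip i x) \<noteq> f x)) = (indicator {x. f (flip i x) \<noteq> f x} :: _ \<Rightarrow> real)"
      by (auto simp: indicator_def)
    then show ?thesis by (simp add: influence_def expect_def)
  qed
  \<comment> \<open>Whether \<open>i\<close> is pivotal does not depend on \<open>x i\<close>, so
    both branches give the same \<open>h\<close>.\<close>
  also have "\<dots> = p * expect N' h + q * expect N' h"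
    unfolding N(1) expect_insert[OF N(2,3)]
    by (intro arg_cong2[of _ _ _ _ "(+)"] arg_cong[of _ _ "(*) _"] arg_cong[of _ _ "expect N'"])
       (auto simp: h_def flip_def fun_eq_iff of_bool_def)
  also have "\<dots> = expect N' h" by (simp add: algebra_simps)
  also have "expect N' h = weight N' {} (\<lambda>x. of_bool (f (x(i := True))) - of_bool (f (x(i := False))))"
    unfolding h_def by (rule parseval[symmetric]) fact
  finally show ?thesis
    unfolding N(1) using weight_insert[of N' i "{}"] N by simp
qed

lemma total_influence_nonneg: "0 \<le> total_influence N p f"
  by (simp add: total_influence_def influence_def sum_nonneg)

lemma mu_nonneg: "0 \<le> mu N p f"
  unfolding mu_eq_expect by (intro expect_nonneg) simp

section \<open>Bounding the mass above a set by restrictions to 1\<close>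

lemma restrict_one_upd_True:
  "restrict_one J (\<lambda>x. f (x(i := True))) = restrict_one (insert i J) f"
  unfolding restrict_one_def by (intro ext arg_cong[of _ _ f]) auto

text \<open>Averaging over coordinate \<open>i\<close> gives the branch \<open>False\<close> weight
  \<open>q\<close>, and \<open>q \<ge> 1/2\<close>.\<close>

lemma mu_upd_False_le:
  assumes "finite N" "i \<notin> N" "i \<notin> J"
  shows "mu (N - J) p (restrict_one J (\<lambda>x. f (x(i := False)))) \<le>
    2 * mu (insert i N - J) p (restrict_one J f)"
proof -
  have eq: "insert i N - J = insert i (N - J)" using assms by auto
  have upd: "restrict_one J f (x(i := b)) = restrict_one J (\<lambda>x. f (x(i := b))) x" for x b
    unfolding restrict_one_def using assms by (intro arg_cong[of _ _ f] ext) auto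
  define m1 m0 where "m1 = mu (N - J) p (restrict_one J (\<lambda>x. f (x(i := True))))"
    and "m0 = mu (N - J) p (restrict_one J (\<lambda>x. f (x(i := False))))"
  have "mu (insert i N - J) p (restrict_one J f) = p * m1 + q * m0"
    unfolding eq m1_def m0_def mu_eq_expect using assms by (subst expect_insert) (auto simp: upd)
  moreover have "0 \<le> p * m1" "(1/2) * m0 \<le> q * m0"
    using p_pos p_le mu_nonneg unfolding m1_def m0_def
    by (auto intro!: mult_nonneg_nonneg mult_right_mono simp del: times_divide_eq_left)
  ultimately show ?thesis unfolding m0_def by simp
qed

text \<open>Induction on \<open>S\<close>, one derivative at a time. The branch \<open>True\<close>
  moves \<open>i\<close> into \<open>J\<close> and keeps the bound \<beta>; the branch
  \<open>False\<close> satisfies the hypothesis with \<open>2 * \<beta>\<close>, hence the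
  generalisation over \<beta>.\<close>

lemma weight_le_of_restrict:
  assumes "finite S" "finite N" "S \<subseteq> N"
    and "\<And>J. J \<subseteq> S \<Longrightarrow> mu (N - J) p (restrict_one J f) \<le> \<beta>"
  shows "weight N S (\<lambda>x. of_bool (f x)) \<le> (6 * p * q) ^ card S * \<beta>"
  using assms
proof (induction S arbitrary: N f \<beta>)
  case empty
  have "weight N {} (\<lambda>x. of_bool (f x)) = mu N p f"
    unfolding parseval[OF empty.prems(1)] mu_eq_expect
    by (intro arg_cong[of _ _ "expect N"]) auto
  also have "\<dots> \<le> \<beta>"
    using empty.prems(3)[of "{}"] by (simp add: restrict_one_def)
  finally show ?case by simp
next
  case (insert i S)
  define N' where "N' = N - {i}"
  have N: "N = insert i N'" "finite N'" "i \<notin> N'" and "S \<subseteq> N'"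
    using insert by (auto simp: N'_def)
  have NJ: "N' - J = N - insert i J" for J unfolding N'_def by auto
  define f1 f0 where "f1 = (\<lambda>x. f (x(i := True)))" and "f0 = (\<lambda>x. f (x(i := False)))"
  have 1: "weight N' S (\<lambda>x. of_bool (f1 x)) \<le> (6 * p * q) ^ card S * \<beta>"
  proof (rule insert.IH)
    fix J assume "J \<subseteq> S"
    then show "mu (N' - J) p (restrict_one J f1) \<le> \<beta>"
      unfolding f1_def restrict_one_upd_True NJ by (intro insert.prems(3)) auto
  qed fact+
  have 0: "weight N' S (\<lambda>x. of_bool (f0 x)) \<le> (6 * p * q) ^ card S * (2 * \<beta>)"
  proof (rule insert.IH)
    fix J assume J: "J \<subseteq> S"
    then have "mu (N' - J) p (restrict_one J f0) \<le> 2 * mu (N - J) p (restrict_one J f)"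
      unfolding f0_def N(1) using N insert.hyps by (intro mu_upd_False_le) auto
    then show "mu (N' - J) p (restrict_one J f0) \<le> 2 * \<beta>"
      using insert.prems(3)[of J] J by fastforce
  qed fact+
  have "weight N (insert i S) (\<lambda>x. of_bool (f x)) =
      p * q * weight N' S (\<lambda>x. of_bool (f1 x) - of_bool (f0 x))"
    unfolding N(1) f1_def f0_def using insert N by (intro weight_insert) auto
  \<comment> \<open>The 6 is 2 * 1 + 2 * 2: \<open>weight_diff_le\<close> doubles both branches, and
    the second already carries \<open>2 * \<beta>\<close>.\<close>
  also have "\<dots> \<le> p * q * (2 * ((6 * p * q) ^ card S * \<beta>) + 2 * ((6 * p * q) ^ card S * (2 * \<beta>)))"
  proof (intro mult_left_mono)
    show "weight N' S (\<lambda>x. of_bool (f1 x) - of_bool (f0 x)) \<le>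
        2 * ((6 * p * q) ^ card S * \<beta>) + 2 * ((6 * p * q) ^ card S * (2 * \<beta>))"
      using 1 0 weight_diff_le[OF N(2), of S "\<lambda>x. of_bool (f1 x)" "\<lambda>x. of_bool (f0 x)"] by argo
  qed (use p_pos q_pos in simp)
  also have "\<dots> = (6 * p * q) ^ card (insert i S) * \<beta>"
    using insert.hyps by (simp add: algebra_simps)
  finally show ?case .
qed

section \<open>A hypercontractive inequality that tracks the bias\<close>

definition synth :: "nat set \<Rightarrow> (nat set \<Rightarrow> real) \<Rightarrow> (nat \<Rightarrow> bool) \<Rightarrow> real" where
  "synth N a x = (\<Sum>S\<in>{{}..N}. a S * character S x)"

text \<open>
  This is the mass above \<open>S\<close> of the function with coefficients \<open>2 ^ card T * a T\<close>, which the noise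
  operator with parameter \<open>1 / 2\<close> maps to \<open>synth N a\<close>.
\<close>

definition upweight :: "nat set \<Rightarrow> (nat set \<Rightarrow> real) \<Rightarrow> nat set \<Rightarrow> real" where
  "upweight N a S = (\<Sum>T\<in>{S..N}. 4 ^ card T * (a T)\<^sup>2)"

lemma synth_insert:
  assumes "finite N" "i \<notin> N"
  shows "synth (insert i N) a (x(i := b)) = synth N a x + chi b * synth N (\<lambda>S. a (insert i S)) x"
proof -
  have "a S * character S (x(i := b)) + a (insert i S) * character (insert i S) (x(i := b)) =
      a S * character S x + chi b * (a (insert i S) * character S x)" if "S \<in> {{}..N}" for S
  proof -
    have "i \<notin> S" "finite S" using that assms finite_subset[of S N] by auto
    then show ?thesis by (simp add: character_upd character_insert_upd)
  qed
  then show ?thesis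
    unfolding synth_def using assms by (simp add: sum_Icc_insert sum.distrib sum_distrib_left)
qed

lemma upweight_insert_both:
  assumes "finite N" "i \<notin> N" "i \<notin> S"
  shows "upweight (insert i N) a (insert i S) = 4 * upweight N (\<lambda>S. a (insert i S)) S"
proof -
  have "4 ^ card (insert i T) = (4 * 4 ^ card T :: real)" if "T \<in> {S..N}" for T
    using that assms finite_subset[of T N] by (subst card_insert_disjoint) auto
  then show ?thesis
    unfolding upweight_def using assms
    by (simp add: sum_Icc_insert_both sum_distrib_left mult.assoc)
qed

lemma upweight_insert:
  assumes "finite N" "i \<notin> N" "i \<notin> S"
  shows "upweight (insert i N) a S = upweight N a S + 4 * upweight N (\<lambda>S. a (insert i S)) S"
  unfolding upweight_insert_both[OF assms, symmetric]
  unfolding upweight_def using assms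
  by (simp add: sum_Icc_insert sum_Icc_insert_both sum.distrib)

text \<open>The cubic term in \<open>c\<close> is absorbed into the quadratic and quartic ones,
  while the linear term is kept exactly. Averaging over \<open>c = chi b\<close> then needs only the
  mean, the variance and a fourth-moment bound.\<close>

lemma two_point_pointwise:
  fixes u v s t c :: real
  shows "(u + c * v)\<^sup>2 * (s + c * t)\<^sup>2 \<le>
    u\<^sup>2 * s\<^sup>2 + c * (2 * (u * v * s\<^sup>2 + u\<^sup>2 * s * t)) +
    c\<^sup>2 * (4 * (u\<^sup>2 * t\<^sup>2 + v\<^sup>2 * s\<^sup>2)) + c^4 * (3 * (v\<^sup>2 * t\<^sup>2))"
proof -
  \<comment> \<open>The difference of the two sides is written as a sum of squares.\<close>
  have "u\<^sup>2 * s\<^sup>2 + c * (2 * (u * v * s\<^sup>2 + u\<^sup>2 * s * t)) +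
    c\<^sup>2 * (4 * (u\<^sup>2 * t\<^sup>2 + v\<^sup>2 * s\<^sup>2)) + c^4 * (3 * (v\<^sup>2 * t\<^sup>2)) -
    (u + c * v)\<^sup>2 * (s + c * t)\<^sup>2 =
    2 * (c * (u * t - v * s))\<^sup>2 + (c * t * (u - c * v))\<^sup>2 + (c * v * (s - c * t))\<^sup>2"
    by (simp add: power2_eq_square power4_eq_xxxx algebra_simps)
  moreover have "0 \<le> 2 * (c * (u * t - v * s))\<^sup>2 + (c * t * (u - c * v))\<^sup>2 + (c * v * (s - c * t))\<^sup>2"
    by simp
  ultimately show ?thesis by linarith
qed

lemma two_point:
  fixes u v s t :: real
  shows "p * ((u + chi True * v)\<^sup>2 * (s + chi True * t)\<^sup>2) +
      q * ((u + chi False * v)\<^sup>2 * (s + chi False * t)\<^sup>2) \<le>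
    u\<^sup>2 * s\<^sup>2 + 4 * (u\<^sup>2 * t\<^sup>2) + 4 * (v\<^sup>2 * s\<^sup>2) + 3 / (p * q) * (v\<^sup>2 * t\<^sup>2)"
proof -
  define L Q R where "L = 2 * (u * v * s\<^sup>2 + u\<^sup>2 * s * t)"
    and "Q = 4 * (u\<^sup>2 * t\<^sup>2 + v\<^sup>2 * s\<^sup>2)" and "R = 3 * (v\<^sup>2 * t\<^sup>2)"
  have pt: "(u + c * v)\<^sup>2 * (s + c * t)\<^sup>2 \<le> u\<^sup>2 * s\<^sup>2 + c * L + c\<^sup>2 * Q + c^4 * R" for c
    unfolding L_def Q_def R_def by (rule two_point_pointwise)
  have "p * ((u + chi True * v)\<^sup>2 * (s + chi True * t)\<^sup>2) +
      q * ((u + chi False * v)\<^sup>2 * (s + chi False * t)\<^sup>2) \<le>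
      p * (u\<^sup>2 * s\<^sup>2 + chi True * L + (chi True)\<^sup>2 * Q + (chi True)^4 * R) +
      q * (u\<^sup>2 * s\<^sup>2 + chi False * L + (chi False)\<^sup>2 * Q + (chi False)^4 * R)"
    using p_pos q_pos by (intro add_mono mult_left_mono pt) auto
  also have "\<dots> = u\<^sup>2 * s\<^sup>2 + (p * chi True + q * chi False) * L +
      (p * (chi True)\<^sup>2 + q * (chi False)\<^sup>2) * Q + (p * (chi True)^4 + q * (chi False)^4) * R"
    by (simp add: algebra_simps)
  also have "\<dots> \<le> u\<^sup>2 * s\<^sup>2 + 0 * L + 1 * Q + 1 / (p * q) * R"
    unfolding chi_mean chi_var
    by (intro add_mono order.refl mult_right_mono chi_fourth) (simp add: R_def)
  finally show ?thesis by (simp add: Q_def R_def algebra_simps)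
qed

lemma upweight_nonneg: "0 \<le> upweight N a S"
  unfolding upweight_def by (intro sum_nonneg) simp

text \<open>
  For \<open>a = b\<close> alone the induction fails: Cauchy-Schwarz on the mixed terms is too lossy. The
  bilinear form is stable because it applies to each mixed term separately.
\<close>

lemma bilinear_hypercontractivity:
  assumes "finite N"
  shows "expect N (\<lambda>x. (synth N a x)\<^sup>2 * (synth N b x)\<^sup>2) \<le>
    (\<Sum>S\<in>{{}..N}. (1 / (p * q)) ^ card S * (upweight N a S * upweight N b S))"
  using assms
proof (induction N arbitrary: a b)
  case empty
  have "{{}..{}} = {{} :: nat set}" by auto
  then show ?case by (simp add: synth_def upweight_def expect_empty character_def)
next
  case (insert i N)
  define l where "l = 1 / (p * q)"
  have l_pos: "0 \<le> l" unfolding l_def using p_pos q_pos by simp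
  define a1 b1 where "a1 = (\<lambda>S. a (insert i S))" and "b1 = (\<lambda>S. b (insert i S))"
  define B where "B c d = (\<Sum>S\<in>{{}..N}. l ^ card S * (upweight N c S * upweight N d S))" for c d
  have IH: "expect N (\<lambda>x. (synth N c x)\<^sup>2 * (synth N d x)\<^sup>2) \<le> B c d" for c d
    unfolding B_def l_def by (rule insert.IH)
  have "expect (insert i N) (\<lambda>x. (synth (insert i N) a x)\<^sup>2 * (synth (insert i N) b x)\<^sup>2) =
      expect N (\<lambda>x. p * ((synth N a x + chi True * synth N a1 x)\<^sup>2 * (synth N b x + chi True * synth N b1 x)\<^sup>2) +
       q * ((synth N a x + chi False * synth N a1 x)\<^sup>2 * (synth N b x + chi False * synth N b1 x)\<^sup>2))"
    unfolding expect_insert[OF insert.hyps] synth_insert[OF insert.hyps] a1_def b1_def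
    using insert.hyps by (simp only: expect_add expect_cmult)
  also have "\<dots> \<le> expect N (\<lambda>x. (synth N a x)\<^sup>2 * (synth N b x)\<^sup>2 + 4 * ((synth N a x)\<^sup>2 * (synth N b1 x)\<^sup>2) +
      4 * ((synth N a1 x)\<^sup>2 * (synth N b x)\<^sup>2) + 3 / (p * q) * ((synth N a1 x)\<^sup>2 * (synth N b1 x)\<^sup>2))"
    using insert.hyps by (intro expect_mono two_point)
  also have "\<dots> = expect N (\<lambda>x. (synth N a x)\<^sup>2 * (synth N b x)\<^sup>2) +
      4 * expect N (\<lambda>x. (synth N a x)\<^sup>2 * (synth N b1 x)\<^sup>2) +
      4 * expect N (\<lambda>x. (synth N a1 x)\<^sup>2 * (synth N b x)\<^sup>2) +
      3 / (p * q) * expect N (\<lambda>x. (synth N a1 x)\<^sup>2 * (synth N b1 x)\<^sup>2)"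
    using insert.hyps by (simp only: expect_add expect_cmult)
  also have "\<dots> \<le> B a b + 4 * B a b1 + 4 * B a1 b + 3 / (p * q) * B a1 b1"
    using p_pos q_pos by (intro add_mono mult_left_mono IH) auto
  \<comment> \<open>The coefficient is enlarged to fit the recursion of \<open>upweight\<close>: one
    16 completes the product \<open>(A + 4 * A1) * (B + 4 * B1)\<close> for sets without
    \<open>i\<close>, and \<open>16 * l\<close> is the term for sets containing
    \<open>i\<close>.\<close>
  also have "\<dots> \<le> B a b + 4 * B a b1 + 4 * B a1 b + (16 + 16 * l) * B a1 b1"
  proof -
    have "0 \<le> B a1 b1" unfolding B_def
      using l_pos by (intro sum_nonneg mult_nonneg_nonneg upweight_nonneg) auto
    moreover have "3 / (p * q) \<le> 16 + 16 * l"
    proof -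
      have "3 / (p * q) = 3 * l" by (simp add: l_def)
      then show ?thesis using l_pos by linarith
    qed
    ultimately show ?thesis by (intro add_left_mono mult_right_mono)
  qed
  also have "\<dots> = (\<Sum>S\<in>{{}..N}.
      l ^ card S * ((upweight N a S + 4 * upweight N a1 S) * (upweight N b S + 4 * upweight N b1 S)) +
      l ^ Suc (card S) * ((4 * upweight N a1 S) * (4 * upweight N b1 S)))"
    unfolding B_def sum_distrib_left sum.distrib[symmetric]
    by (intro sum.cong refl) (simp add: algebra_simps)
  also have "\<dots> = (\<Sum>S\<in>{{}..N}.
      l ^ card S * (upweight (insert i N) a S * upweight (insert i N) b S) +
      l ^ card (insert i S) * (upweight (insert i N) a (insert i S) * upweight (insert i N) b (insert i S)))"
  proof (intro sum.cong refl)
    fix S assume "S \<in> {{}..N}"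
    then have "i \<notin> S" "finite S" using insert.hyps finite_subset[of S N] by auto
    then show "l ^ card S * ((upweight N a S + 4 * upweight N a1 S) * (upweight N b S + 4 * upweight N b1 S)) +
      l ^ Suc (card S) * ((4 * upweight N a1 S) * (4 * upweight N b1 S)) =
      l ^ card S * (upweight (insert i N) a S * upweight (insert i N) b S) +
      l ^ card (insert i S) * (upweight (insert i N) a (insert i S) * upweight (insert i N) b (insert i S))"
      using insert.hyps by (simp add: upweight_insert upweight_insert_both a1_def b1_def)
  qed
  also have "\<dots> = (\<Sum>S\<in>{{}..insert i N}.
      l ^ card S * (upweight (insert i N) a S * upweight (insert i N) b S))"
    using insert.hyps by (simp add: sum_Icc_insert)
  finally show ?case unfolding l_def .
qed

text \<open>Each \<open>T\<close> is counted once for each of its \<open>2 ^ card T\<close> subsets,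
  turning 4 into 8.\<close>

lemma sum_upweight:
  assumes "finite N"
  shows "(\<Sum>S\<in>{{}..N}. upweight N a S) = (\<Sum>T\<in>{{}..N}. 8 ^ card T * (a T)\<^sup>2)"
proof -
  have "(\<Sum>S\<in>{{}..N}. upweight N a S) =
      (\<Sum>S\<in>{{}..N}. \<Sum>T | T \<in> {{}..N} \<and> S \<subseteq> T. 4 ^ card T * (a T)\<^sup>2)"
    unfolding upweight_def by (intro sum.cong) auto
  also have "\<dots> = (\<Sum>T\<in>{{}..N}. \<Sum>S | S \<in> {{}..N} \<and> S \<subseteq> T. 4 ^ card T * (a T)\<^sup>2)"
    using finite_set_Icc[OF assms] by (intro sum.swap_restrict)
  also have "\<dots> = (\<Sum>T\<in>{{}..N}. 8 ^ card T * (a T)\<^sup>2)"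
  proof (intro sum.cong refl)
    fix T assume "T \<in> {{}..N}"
    then have "{S \<in> {{}..N}. S \<subseteq> T} = Pow T" "finite T" using finite_subset[of T N] assms by auto
    then show "(\<Sum>S | S \<in> {{}..N} \<and> S \<subseteq> T. 4 ^ card T * (a T)\<^sup>2) = 8 ^ card T * (a T)\<^sup>2"
      by (simp add: card_Pow flip: power_mult_distrib)
  qed
  finally show ?thesis .
qed

section \<open>The low-degree part of a Boolean function\<close>

lemma low_degree_bound:
  assumes N: "finite N"
    and \<beta>: "\<And>J. J \<subseteq> N \<Longrightarrow> card J \<le> d \<Longrightarrow> mu (N - J) p (restrict_one J f) \<le> \<beta>"
    and M: "M = (\<Sum>S\<in>{{}..N}. if card S \<le> d then (coef N (\<lambda>x. of_bool (f x)) S)\<^sup>2 else 0)"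
  shows "M ^ 4 \<le> (mu N p f) ^ 3 * (192 ^ d * \<beta> * M)"
proof -
  define F :: "(nat \<Rightarrow> bool) \<Rightarrow> real" where "F x = of_bool (f x)" for x
  define a where "a S = (if card S \<le> d then coef N F S else 0)" for S
  define g where "g = synth N a"
  define m where "m = mu N p f"
  have F2: "(F x)\<^sup>2 = F x" for x by (simp add: F_def)
  have FF: "F x * (F x * t) = F x * t" "(F x * t)\<^sup>2 = F x * t\<^sup>2" for x t by (simp_all add: F_def)
  have m: "m = expect N F" unfolding m_def mu_eq_expect F_def ..
  have m0: "0 \<le> m" unfolding m_def by (rule mu_nonneg)
  have Ma: "M = (\<Sum>S\<in>{{}..N}. (a S)\<^sup>2)"
    unfolding M a_def F_def by (intro sum.cong) auto
  have \<beta>0: "0 \<le> \<beta>" using \<beta>[of "{}"] mu_nonneg[of N "restrict_one {} f"] by simp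
  have M_expect: "M = expect N (\<lambda>x. F x * g x)"
  proof -
    have "(\<lambda>x. F x * g x) = (\<lambda>x. \<Sum>S\<in>{{}..N}. a S * (F x * character S x))"
      by (simp add: g_def synth_def sum_distrib_left algebra_simps)
    then have "expect N (\<lambda>x. F x * g x) = (\<Sum>S\<in>{{}..N}. a S * coef N F S)"
      by (simp only: expect_sum[OF N] expect_cmult coef_def)
    also have "\<dots> = M" unfolding Ma by (intro sum.cong) (auto simp: a_def power2_eq_square)
    finally show ?thesis ..
  qed
  \<comment> \<open>As \<open>F\<close> is 0/1-valued, an extra factor \<open>F\<close> is free;
    each use of Cauchy-Schwarz therefore gains a factor \<open>m\<close>.\<close>
  have cs1: "M\<^sup>2 \<le> m * expect N (\<lambda>x. F x * (g x)\<^sup>2)"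
    using cauchy_schwarz_expect[OF N, of F "\<lambda>x. F x * g x"]
    by (simp only: M_expect m F2 FF)
  have cs2: "(expect N (\<lambda>x. F x * (g x)\<^sup>2))\<^sup>2 \<le> m * expect N (\<lambda>x. (g x)\<^sup>2 * (g x)\<^sup>2)"
    using cauchy_schwarz_expect[OF N, of F "\<lambda>x. (g x)\<^sup>2"]
    by (simp only: m F2 power2_eq_square[of "(g _)\<^sup>2"])
  have "M ^ 4 = (M\<^sup>2)\<^sup>2" by simp
  also have "\<dots> \<le> (m * expect N (\<lambda>x. F x * (g x)\<^sup>2))\<^sup>2"
    using cs1 by (intro power_mono) auto
  also have "\<dots> \<le> m\<^sup>2 * (m * expect N (\<lambda>x. (g x)\<^sup>2 * (g x)\<^sup>2))"
    unfolding power_mult_distrib using cs2 by (intro mult_left_mono) auto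
  also have "\<dots> = m ^ 3 * expect N (\<lambda>x. (g x)\<^sup>2 * (g x)\<^sup>2)"
    by (simp add: power2_eq_square power3_eq_cube)
  also have "\<dots> \<le> m ^ 3 * (192 ^ d * \<beta> * M)"
  proof (intro mult_left_mono)
    \<comment> \<open>Only one of the two factors \<open>upweight\<close> is bounded uniformly; the
      other is kept to be summed into \<open>M\<close>. The factors \<open>p * q\<close> cancel
      here, leaving 24 = 4 * 6, and \<open>sum_upweight\<close> later contributes the 8 in
      192.\<close>
    have up: "(1 / (p * q)) ^ card S * (upweight N a S * upweight N a S) \<le>
        24 ^ d * \<beta> * upweight N a S" if S: "S \<in> {{}..N}" for S
    proof (cases "card S \<le> d")
      case True
      have fin: "finite S" using S N finite_subset by auto
      have "upweight N a S \<le> (\<Sum>T\<in>{S..N}. 4 ^ d * (coef N F T)\<^sup>2)"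
        unfolding upweight_def a_def
        by (intro sum_mono) (auto intro!: mult_right_mono power_increasing)
      also have "\<dots> = 4 ^ d * weight N S F"
        by (simp add: weight_def sum_distrib_left)
      also have "\<dots> \<le> 4 ^ d * ((6 * p * q) ^ card S * \<beta>)"
      proof (intro mult_left_mono)
        show "weight N S F \<le> (6 * p * q) ^ card S * \<beta>"
          unfolding F_def
        proof (rule weight_le_of_restrict)
          fix J assume "J \<subseteq> S"
          then have "J \<subseteq> N" "card J \<le> d"
            using S True card_mono[OF fin, of J] by auto
          then show "mu (N - J) p (restrict_one J f) \<le> \<beta>" by (rule \<beta>)
        qed (use S N fin in auto)
      qed simp
      finally have "(1 / (p * q)) ^ card S * upweight N a S \<le>
          (1 / (p * q)) ^ card S * (4 ^ d * ((6 * p * q) ^ card S * \<beta>))"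
        using p_pos q_pos by (intro mult_left_mono) auto
      also have "\<dots> = 4 ^ d * (((1 / (p * q)) * (6 * p * q)) ^ card S * \<beta>)"
        unfolding power_mult_distrib[of "1 / (p * q)"] by simp
      also have "(1 / (p * q)) * (6 * p * q) = 6"
        using p_pos q_pos by simp
      also have "4 ^ d * (6 ^ card S * \<beta>) \<le> 4 ^ d * (6 ^ d * \<beta>)"
        using True \<beta>0 by (intro mult_left_mono mult_right_mono power_increasing) auto
      also have "4 ^ d * (6 ^ d * \<beta>) = (4 * 6) ^ d * \<beta>"
        unfolding power_mult_distrib by simp
      finally have "(1 / (p * q)) ^ card S * upweight N a S \<le> 24 ^ d * \<beta>" by simp
      from mult_right_mono[OF this upweight_nonneg[of N a S]] show ?thesis
        by (simp only: mult.assoc)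
    next
      case False
      \<comment> \<open>A superset of \<open>S\<close> also has more than \<open>d\<close> elements,
        so the truncation removes it.\<close>
      have "a T = 0" if "T \<in> {S..N}" for T
        using that False card_mono[of T S] N finite_subset[of T N] by (auto simp: a_def)
      then have "upweight N a S = 0" by (simp add: upweight_def)
      then show ?thesis by simp
    qed
    have "expect N (\<lambda>x. (g x)\<^sup>2 * (g x)\<^sup>2) \<le>
        (\<Sum>S\<in>{{}..N}. (1 / (p * q)) ^ card S * (upweight N a S * upweight N a S))"
      unfolding g_def by (rule bilinear_hypercontractivity[OF N])
    also have "\<dots> \<le> (\<Sum>S\<in>{{}..N}. 24 ^ d * \<beta> * upweight N a S)"
      by (intro sum_mono up)
    also have "\<dots> = 24 ^ d * \<beta> * (\<Sum>T\<in>{{}..N}. 8 ^ card T * (a T)\<^sup>2)"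
      by (simp add: sum_upweight[OF N] flip: sum_distrib_left)
    also have "\<dots> \<le> 24 ^ d * \<beta> * (\<Sum>T\<in>{{}..N}. 8 ^ d * (a T)\<^sup>2)"
      using \<beta>0 by (intro mult_left_mono sum_mono)
        (auto simp: a_def intro!: mult_right_mono power_increasing)
    also have "\<dots> = (24 * 8) ^ d * \<beta> * M"
      unfolding Ma power_mult_distrib by (simp flip: sum_distrib_left)
    finally show "expect N (\<lambda>x. (g x)\<^sup>2 * (g x)\<^sup>2) \<le> 192 ^ d * \<beta> * M" by simp
  qed (use m0 in simp)
  finally show ?thesis unfolding m_def .
qed

text \<open>Double counting: the coefficient at \<open>S\<close> enters the mass above
  \<open>{i}\<close> once for each \<open>i\<close> in \<open>S\<close>.\<close>

lemma sum_card_coef: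
  assumes N: "finite N"
  shows "(\<Sum>S\<in>{{}..N}. card S * (coef N (\<lambda>x. of_bool (f x)) S)\<^sup>2) = p * q * total_influence N p f"
proof -
  define c where "c S = (coef N (\<lambda>x. of_bool (f x)) S)\<^sup>2" for S
  have "p * q * total_influence N p f = (\<Sum>i\<in>N. weight N {i} (\<lambda>x. of_bool (f x)))"
    using N by (simp add: total_influence_def sum_distrib_left weight_singleton_influence)
  also have "\<dots> = (\<Sum>i\<in>N. \<Sum>S | S \<in> {{}..N} \<and> i \<in> S. c S)"
    unfolding weight_def c_def by (intro sum.cong) auto
  also have "\<dots> = (\<Sum>S\<in>{{}..N}. \<Sum>i | i \<in> N \<and> i \<in> S. c S)"
    using N finite_set_Icc by (intro sum.swap_restrict) auto
  also have "\<dots> = (\<Sum>S\<in>{{}..N}. card S * c S)"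
  proof (intro sum.cong refl)
    fix S assume "S \<in> {{}..N}"
    then have "{i \<in> N. i \<in> S} = S" by auto
    then show "(\<Sum>i | i \<in> N \<and> i \<in> S. c S) = card S * c S" by simp
  qed
  finally show ?thesis unfolding c_def ..
qed

text \<open>A Markov argument on the degree: a set with more than \<open>d\<close> elements has at
  least \<open>2 * K\<close>, so its mass is at most \<open>card S / (2 * K)\<close> times itself.
  The influence bound makes all these terms together at most half of the mean.\<close>

lemma low_degree_mass:
  assumes N: "finite N" and "0 < K" and I: "p * total_influence N p f < K * mu N p f"
    and d: "2 * K < Suc d"
    and M: "M = (\<Sum>S\<in>{{}..N}. if card S \<le> d then (coef N (\<lambda>x. of_bool (f x)) S)\<^sup>2 else 0)"
  shows "mu N p f / 2 \<le> M"
proof -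
  define c where "c S = (coef N (\<lambda>x. of_bool (f x)) S)\<^sup>2" for S
  have "mu N p f = weight N {} (\<lambda>x. of_bool (f x))"
    unfolding parseval[OF N] mu_eq_expect by (intro arg_cong[of _ _ "expect N"]) auto
  also have "\<dots> \<le> (\<Sum>S\<in>{{}..N}. (if card S \<le> d then c S else 0) + 1 / (2 * K) * (card S * c S))"
    unfolding weight_def c_def[symmetric]
  proof (intro sum_mono)
    fix S
    have c0: "0 \<le> c S" by (simp add: c_def)
    show "c S \<le> (if card S \<le> d then c S else 0) + 1 / (2 * K) * (card S * c S)"
    proof (cases "card S \<le> d")
      case False
      then have "2 * K \<le> card S" using d by linarith
      then have "2 * K * c S \<le> card S * c S" using c0 by (rule mult_right_mono)
      then show ?thesis using False \<open>0 < K\<close> by (simp add: field_simps)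
    qed (use c0 \<open>0 < K\<close> in simp)
  qed
  also have "\<dots> = M + 1 / (2 * K) * (p * q * total_influence N p f)"
    unfolding sum.distrib sum_distrib_left[symmetric] M c_def sum_card_coef[OF N] ..
  also have "\<dots> \<le> M + 1 / (2 * K) * (K * mu N p f)"
  proof -
    have "p * q * total_influence N p f \<le> p * 1 * total_influence N p f"
      using p_pos total_influence_nonneg by (intro mult_right_mono mult_left_mono) auto
    then show ?thesis
      using I \<open>0 < K\<close> by (intro add_left_mono mult_left_mono) auto
  qed
  finally show ?thesis using \<open>0 < K\<close> by simp
qed

end

section \<open>Contradiction by choice of the constant\<close>

theorem theorem1p5:
  shows "\<exists>C::real. C > 0 \<and>
    (\<forall>(n::nat) (p::real) (K::real) (f :: (nat \<Rightarrow> bool) \<Rightarrow> bool).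
       0 < p \<and> p \<le> 1 / 2 \<and> K \<ge> 1 \<and>
       p * total_influence {1..n} p f < K * mu {1..n} p f \<longrightarrow>
       (\<exists>J. J \<subseteq> {1..n} \<and> real (card J) \<le> C * K \<and>
            mu ({1..n} - J) p (restrict_one J f) \<ge> exp (- C * K)))"
proof (intro exI[of _ "2 * ln 192 + ln 8 + 2 :: real"] conjI allI impI)
  show "0 < 2 * ln 192 + ln 8 + (2 :: real)" by (intro add_pos_pos) auto
  fix n :: nat and p K :: real and f :: "(nat \<Rightarrow> bool) \<Rightarrow> bool"
  define N where "N = {1..n}"
  \<comment> \<open>In \<open>C * K\<close>, the part \<open>2 * ln 192\<close> pays for
    \<open>192 ^ d\<close> with \<open>d \<le> 2 * K\<close>, \<open>ln 8\<close> pays for the loss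
    \<open>(1/2)^3\<close> from \<open>half\<close>, and 2 makes the final inequality
    strict.\<close>
  define C :: real where "C = 2 * ln 192 + ln 8 + 2"
  assume asm: "0 < p \<and> p \<le> 1 / 2 \<and> K \<ge> 1 \<and>
    p * total_influence {1..n} p f < K * mu {1..n} p f"
  then interpret bias p by unfold_locales auto
  have N: "finite N" by (simp add: N_def)
  have K: "1 \<le> K" and I: "p * total_influence N p f < K * mu N p f"
    using asm by (auto simp: N_def)
  define d where "d = nat \<lfloor>2 * K\<rfloor>"
  have d: "real d \<le> 2 * K" "2 * K < Suc d"
    using K real_of_int_floor_add_one_gt[of "2 * K"] by (auto simp: d_def add.commute)
  define M where "M = (\<Sum>S\<in>{{}..N}. if card S \<le> d then (coef N (\<lambda>x. of_bool (f x)) S)\<^sup>2 else 0)"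
  \<comment> \<open>The strict hypothesis excludes a vanishing mean, so \<open>mu N p f\<close> and
    \<open>M\<close> can be cancelled below.\<close>
  have "0 \<le> p * total_influence N p f"
    using p_pos total_influence_nonneg by simp
  then have "0 < K * mu N p f" using I by linarith
  then have mpos: "0 < mu N p f" using K by (simp add: zero_less_mult_iff)
  have half: "mu N p f / 2 \<le> M"
    using N K I d(2) M_def by (intro low_degree_mass[of N K f d]) auto
  then have Mpos: "0 < M" using mpos by simp
  have "\<exists>J. J \<subseteq> N \<and> card J \<le> d \<and> exp (- C * K) < mu (N - J) p (restrict_one J f)"
  proof (rule ccontr)
    assume "\<not> ?thesis"
    \<comment> \<open>If no such \<open>J\<close> exists, \<open>low_degree_bound\<close> applies
      with \<beta> equal to \<open>exp (- C * K)\<close>.\<close>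
    then have "M ^ 4 \<le> (mu N p f) ^ 3 * (192 ^ d * exp (- C * K) * M)"
      using N M_def by (intro low_degree_bound) (auto simp: not_less)
    then have "M ^ 3 * M \<le> (mu N p f) ^ 3 * (192 ^ d * exp (- C * K)) * M"
      by (simp add: power4_eq_xxxx power3_eq_cube mult_ac)
    then have "M ^ 3 \<le> (mu N p f) ^ 3 * (192 ^ d * exp (- C * K))"
      using Mpos by simp
    moreover have "(mu N p f / 2) ^ 3 \<le> M ^ 3"
      using half mpos by (intro power_mono) auto
    ultimately have "(mu N p f) ^ 3 * (1 / 8) \<le> (mu N p f) ^ 3 * (192 ^ d * exp (- C * K))"
      by (simp add: power_divide)
    then have "1 / 8 \<le> 192 ^ d * exp (- C * K)"
      using mpos by simp
    also have "(192 :: real) ^ d = exp (d * ln 192)"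
      by (simp add: exp_of_nat_mult)
    also have "\<dots> * exp (- C * K) = exp (d * ln 192 - C * K)"
      by (simp flip: exp_add)
    also have "\<dots> < exp (- ln 8)"
    proof -
      have "d * ln 192 \<le> 2 * K * ln 192"
        using d(1) by (intro mult_right_mono) auto
      moreover have "1 * ln 8 \<le> K * ln (8 :: real)" using K by (intro mult_right_mono) auto
      moreover have "C * K = 2 * K * ln 192 + K * ln 8 + 2 * K"
        by (simp add: C_def algebra_simps)
      ultimately have "d * ln 192 - C * K < - ln 8" using K by linarith
      then show ?thesis by (simp only: exp_less_mono)
    qed
    finally show False by (simp add: exp_minus)
  qed
  then obtain J where J: "J \<subseteq> N" "card J \<le> d" "exp (- C * K) < mu (N - J) p (restrict_one J f)"
    by blast
  have "real (card J) \<le> 2 * K" using J(2) d(1) by linarith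
  also have "\<dots> \<le> C * K" unfolding C_def using K by (intro mult_right_mono) auto
  finally show "\<exists>J. J \<subseteq> {1..n} \<and> real (card J) \<le> (2 * ln 192 + ln 8 + 2) * K \<and>
      exp (- (2 * ln 192 + ln 8 + 2) * K) \<le> mu ({1..n} - J) p (restrict_one J f)"
    using J unfolding N_def C_def by (intro exI[of _ J]) auto
qed

end
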